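(* Let $\theta_0 > \theta_1 > \theta_2$ be real numbers and let $\Gamma$ be a graph in $\mathcal{G}(\theta_0,\theta_1,\theta_2)$. If the complement of $\Gamma$ is disconnected, then $\Gamma$ is a cone or $\Gamma$ is complete bipartite.
   Context: All graphs are finite and simple; eigenvalues of a graph are those of its adjacency matrix. For $\theta_0 > \theta_1 > \theta_2$, $\mathcal{G}(\theta_0,\theta_1,\theta_2)$ denotes the set of connected nonregular graphs having precisely three distinct eigenvalues $\theta_0$, $\theta_1$, $\theta_2$. An $n$-vertex graph is called a cone if it has a vertex of valency (degree) $n-1$. *)

theory Defs
  imports "Graph_Theory.Graph_Theory" "Jordan_Normal_Form.Spectral_Radius"
begin

text \<open>
  Finite simple graphs are the loop-free symmetric digraphs of \<^locale>\<open>pair_graph\<close>: every edge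
  is represented by its two opposite arcs, so the degree of a vertex is its out-degree.
\<close>

definition complement_graph :: "'a pair_pre_digraph \<Rightarrow> 'a pair_pre_digraph" where
  "complement_graph G = \<lparr> pverts = pverts G,
     parcs = {(u, v). u \<in> pverts G \<and> v \<in> pverts G \<and> u \<noteq> v \<and> (u, v) \<notin> parcs G} \<rparr>"

definition regular_graph :: "'a pair_pre_digraph \<Rightarrow> bool" where
  "regular_graph G \<longleftrightarrow> (\<exists>k. \<forall>v \<in> pverts G. out_degree (with_proj G) v = k)"

definition cone_graph :: "'a pair_pre_digraph \<Rightarrow> bool" where
  "cone_graph G \<longleftrightarrow> (\<exists>v \<in> pverts G. out_degree (with_proj G) v = card (pverts G) - 1)"

text \<open>Both colour classes are required to be nonempty.\<close>

definition complete_bipartite_graph :: "'a pair_pre_digraph \<Rightarrow> bool" where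
  "complete_bipartite_graph G \<longleftrightarrow>
     (\<exists>m n. 1 \<le> m \<and> 1 \<le> n \<and> complete_bipartite_digraph m n (with_proj G))"

definition adjacency_matrix :: "'a list \<Rightarrow> 'a pair_pre_digraph \<Rightarrow> real mat" where
  "adjacency_matrix vs G =
     mat (length vs) (length vs) (\<lambda>(i, j). if (vs ! i, vs ! j) \<in> parcs G then 1 else 0)"

text \<open>
  The eigenvalues do not depend on the enumeration \<open>vs\<close> of the vertices; see
  \<open>graph_eigenvalues_eq_spectrum\<close> below. The real spectrum is the whole spectrum, since the
  matrix is real symmetric.
\<close>

definition graph_eigenvalues :: "'a pair_pre_digraph \<Rightarrow> real set" where
  "graph_eigenvalues G =
     (\<Union>vs \<in> {vs. distinct vs \<and> set vs = pverts G}. spectrum (adjacency_matrix vs G))"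

definition three_eigenvalue_graphs :: "real \<Rightarrow> real \<Rightarrow> real \<Rightarrow> 'a pair_pre_digraph set" where
  "three_eigenvalue_graphs \<theta>0 \<theta>1 \<theta>2 =
     {G. pair_graph G \<and> Digraph_Component.connected (with_proj G) \<and> \<not> regular_graph G
         \<and> graph_eigenvalues G = {\<theta>0, \<theta>1, \<theta>2}}"

lemma spectrum_adjacency_matrix_iff:
  assumes d: "distinct vs"
  shows "\<theta> \<in> spectrum (adjacency_matrix vs G) \<longleftrightarrow>
    (\<exists>f. (\<exists>x \<in> set vs. f x \<noteq> 0) \<and>
         (\<forall>x \<in> set vs. (\<Sum>y \<in> set vs. if (x, y) \<in> parcs G then f y else 0) = \<theta> * f x))"
    (is "_ \<longleftrightarrow> (\<exists>f. ?P f)")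
proof
  let ?n = "length vs" and ?A = "adjacency_matrix vs G"
  have bij: "bij_betw ((!) vs) {0..<?n} (set vs)"
    using bij_betw_nth[OF d] by (simp add: atLeast0LessThan)
  have row: "(?A *\<^sub>v v) $ i =
      (\<Sum>y \<in> set vs. if (vs ! i, y) \<in> parcs G then f y else 0)"
    if "v \<in> carrier_vec ?n" "i < ?n" and f: "\<And>j. j < ?n \<Longrightarrow> f (vs ! j) = v $ j" for v f i
  proof -
    have "(?A *\<^sub>v v) $ i = (\<Sum>j \<in> {0..<?n}. if (vs ! i, vs ! j) \<in> parcs G then v $ j else 0)"
      using that(1,2) by (auto simp: adjacency_matrix_def scalar_prod_def intro!: sum.cong)
    also have "\<dots> = (\<Sum>j \<in> {0..<?n}. if (vs ! i, vs ! j) \<in> parcs G then f (vs ! j) else 0)"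
      using f by (intro sum.cong) auto
    also have "\<dots> = (\<Sum>y \<in> set vs. if (vs ! i, y) \<in> parcs G then f y else 0)"
      by (rule sum.reindex_bij_betw[OF bij])
    finally show ?thesis .
  qed
  have dims: "dim_row ?A = ?n" "dim_col ?A = ?n" by (simp_all add: adjacency_matrix_def)
  {
    assume "\<theta> \<in> spectrum ?A"
    then obtain v where v: "v \<in> carrier_vec ?n" "v \<noteq> 0\<^sub>v ?n" "?A *\<^sub>v v = \<theta> \<cdot>\<^sub>v v"
      by (auto simp: spectrum_def eigenvalue_def eigenvector_def dims)
    define f where "f x = v $ (the_inv_into {0..<?n} ((!) vs) x)" for x
    have f: "f (vs ! j) = v $ j" if "j < ?n" for j
      using bij that by (simp add: f_def the_inv_into_f_f bij_betw_def)
    have "\<exists>x \<in> set vs. f x \<noteq> 0"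
    proof (rule ccontr)
      assume "\<not> ?thesis"
      then have "v = 0\<^sub>v ?n" using v(1) f by (intro eq_vecI) auto
      with v(2) show False by simp
    qed
    moreover have "\<forall>x \<in> set vs. (\<Sum>y \<in> set vs. if (x, y) \<in> parcs G then f y else 0) = \<theta> * f x"
    proof
      fix x assume "x \<in> set vs"
      then obtain i where i: "i < ?n" "x = vs ! i" by (auto simp: in_set_conv_nth)
      show "(\<Sum>y \<in> set vs. if (x, y) \<in> parcs G then f y else 0) = \<theta> * f x"
        using row[OF v(1) i(1) f] v(1,3) i f by simp
    qed
    ultimately show "\<exists>f. ?P f" by blast
  }
  {
    assume "\<exists>f. ?P f"
    then obtain f where P: "?P f" by blast
    define v where "v = vec ?n (\<lambda>i. f (vs ! i))"
    have v: "v \<in> carrier_vec ?n" by (simp add: v_def)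
    have f: "f (vs ! j) = v $ j" if "j < ?n" for j using that by (simp add: v_def)
    have "v \<noteq> 0\<^sub>v ?n"
    proof
      assume v0: "v = 0\<^sub>v ?n"
      obtain j where "j < ?n" "f (vs ! j) \<noteq> 0" using P by (auto simp: in_set_conv_nth)
      with f[of j] v0 show False by simp
    qed
    moreover have "?A *\<^sub>v v = \<theta> \<cdot>\<^sub>v v"
    proof (rule eq_vecI)
      fix i assume "i < dim_vec (\<theta> \<cdot>\<^sub>v v)"
      then have i: "i < ?n" using v by simp
      show "(?A *\<^sub>v v) $ i = (\<theta> \<cdot>\<^sub>v v) $ i"
        using row[OF v i f] P i v f[OF i] by simp
    qed (use v dims in simp)
    ultimately show "\<theta> \<in> spectrum ?A"
      using v by (auto simp: spectrum_def eigenvalue_def eigenvector_def dims)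
  }
qed

lemma graph_eigenvalues_eq_spectrum:
  assumes "distinct vs" "set vs = pverts G"
  shows "graph_eigenvalues G = spectrum (adjacency_matrix vs G)"
proof -
  have "spectrum (adjacency_matrix ws G) = spectrum (adjacency_matrix vs G)"
    if "distinct ws" "set ws = pverts G" for ws
    using that assms by (auto simp: spectrum_adjacency_matrix_iff)
  with assms show ?thesis unfolding graph_eigenvalues_def by blast
qed

end

theory Submission
  imports Defs "HOL-Analysis.Function_Topology"
begin

text \<open>
  Since the adjacency matrix \<open>A\<close> is symmetric and its largest eigenvalue \<open>\<theta>0\<close> has a one-dimensional
  eigenspace spanned by a positive vector, \<open>(A - \<theta>1)(A - \<theta>2) = \<alpha>\<alpha>\<^sup>T\<close> with \<open>\<alpha> > 0\<close>. Entrywise this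
  determines degrees and numbers of common neighbours from \<open>\<alpha>\<close>. If the vertex set is a join of
  \<open>U\<close> and \<open>W\<close>, counting common neighbours of \<open>x \<in> U\<close> and \<open>y \<in> W\<close> shows that
  \<open>\<alpha>\<^sub>x\<^sup>2 + \<alpha>\<^sub>y\<^sup>2 - \<alpha>\<^sub>x\<alpha>\<^sub>y\<close> is constant, so two values of \<open>\<alpha>\<close> on \<open>U\<close> force \<open>\<alpha>\<close> to be their sum on
  all of \<open>W\<close>. For a graph that is not a cone this is excluded by counting walks inside \<open>W\<close>.
  Hence \<open>\<alpha>\<close> is constant on \<open>U\<close> and on \<open>W\<close>, both sides are regular, and the resulting equations for
  the four parameters leave only a regular graph or two edgeless sides.
\<close>

section \<open>Symmetric kernels on a finite set\<close>

locale symmetric_kernel =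
  fixes V :: "'a set" and a :: "'a \<Rightarrow> 'a \<Rightarrow> real"
  assumes finV: "finite V"
    and sym: "a x y = a y x"
begin

definition app :: "('a \<Rightarrow> real) \<Rightarrow> 'a \<Rightarrow> real" where
  "app f x = (if x \<in> V then \<Sum>y\<in>V. a x y * f y else 0)"

definition ip :: "('a \<Rightarrow> real) \<Rightarrow> ('a \<Rightarrow> real) \<Rightarrow> real" where
  "ip f g = (\<Sum>x\<in>V. f x * g x)"

text \<open>Vectors are functions that vanish off \<open>V\<close>, so equality of functions is
  equality of vectors, and \<open>orth {}\<close> is the whole space.\<close>

definition orth :: "('a \<Rightarrow> real) set \<Rightarrow> ('a \<Rightarrow> real) set" where
  "orth U = {f. (\<forall>x. x \<notin> V \<longrightarrow> f x = 0) \<and> (\<forall>u\<in>U. ip f u = 0)}"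

lemma sum_indicator: "y \<in> V \<Longrightarrow> (\<Sum>z\<in>V. h z * (if z = y then 1 else 0 :: real)) = h y"
  using finV by (subst sum.cong[OF refl, of _ _ "\<lambda>z. if z = y then h z else 0"]) auto

lemma app_lin: "app (\<lambda>x. c * f x + d * g x) = (\<lambda>x. c * app f x + d * app g x)"
  by (auto simp: fun_eq_iff app_def sum_distrib_left sum.distrib algebra_simps)

lemma ip_lin_left: "ip (\<lambda>x. c * f x + d * g x) h = c * ip f h + d * ip g h"
  by (simp add: ip_def sum_distrib_left sum.distrib algebra_simps)

lemma ip_commute: "ip f g = ip g f"
  by (simp add: ip_def mult.commute)

lemma ip_lin_right: "ip h (\<lambda>x. c * f x + d * g x) = c * ip h f + d * ip h g"
  by (simp add: ip_commute[of h] ip_lin_left)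

lemma ip_app: "ip (app f) g = ip f (app g)"
proof -
  have "ip (app f) g = (\<Sum>x\<in>V. \<Sum>y\<in>V. a x y * f y * g x)"
    by (simp add: ip_def app_def sum_distrib_right)
  also have "\<dots> = (\<Sum>y\<in>V. \<Sum>x\<in>V. a x y * f y * g x)"
    by (rule sum.swap)
  also have "\<dots> = ip f (app g)"
    by (simp add: ip_def app_def sum_distrib_left sym mult_ac cong: sum.cong)
  finally show ?thesis .
qed

lemma ip_self_nonneg: "0 \<le> ip f f"
  by (simp add: ip_def sum_nonneg)

lemma ip_self_eq_0: "f \<in> orth U \<Longrightarrow> ip f f = 0 \<longleftrightarrow> f = (\<lambda>_. 0)"
  using finV by (auto simp: ip_def orth_def sum_nonneg_eq_0_iff fun_eq_iff)

lemma orth_lin: "f \<in> orth U \<Longrightarrow> g \<in> orth U \<Longrightarrow> (\<lambda>x. c * f x + d * g x) \<in> orth U"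
  by (auto simp: orth_def ip_lin_left)

lemma app_scale: "app (\<lambda>x. c * u x) = (\<lambda>x. c * app u x)"
  using app_lin[of c u 0 u] by simp

lemma ip_scale: "ip h (\<lambda>x. c * u x) = c * ip h u"
  using ip_lin_right[of h c u 0 u] by simp

lemma ip_scale_left: "ip (\<lambda>x. c * u x) h = c * ip u h"
  using ip_lin_left[of c u 0 u] by simp

lemma orth_scale: "f \<in> orth U \<Longrightarrow> (\<lambda>x. c * f x) \<in> orth U"
  using orth_lin[of f U f c 0] by simp

lemma app_orth_empty: "app f \<in> orth {}"
  by (simp add: orth_def app_def)

section \<open>Rayleigh quotients and the spectral theorem\<close>

lemma compact_sphere: "compact {f \<in> orth U. ip f f = 1}"
proof -
  \<comment> \<open>A box in the product topology on functions: coordinates in \<open>V\<close>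
    range over [-1, 1], all others are fixed at 0. It is compact by Tychonoff, and the unit sphere
    is a closed subset of it.\<close>
  let ?B = "Pi\<^sub>E UNIV (\<lambda>x. if x \<in> V then {-1..1} else {0::real})"
  have "compactin (product_topology (\<lambda>_. euclidean) UNIV) ?B"
    by (auto simp: compactin_PiE)
  then have B: "compact ?B"
    by (simp add: euclidean_product_topology)
  have cont: "continuous_on UNIV (\<lambda>f. ip f (\<lambda>x. u x))" "continuous_on UNIV (\<lambda>f. ip f f)" for u
    unfolding ip_def by (intro continuous_intros continuous_on_product_coordinates)+
  have "closed ((\<Inter>u\<in>U. {f. ip f u = 0}) \<inter> {f. ip f f = 1})"
    using cont by (intro closed_Int closed_INT ballI closed_Collect_eq) auto
  with B have "compact (?B \<inter> ((\<Inter>u\<in>U. {f. ip f u = 0}) \<inter> {f. ip f f = 1}))"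
    by (rule compact_Int_closed)
  moreover have "\<bar>f x\<bar> \<le> 1" if "ip f f = 1" "x \<in> V" for f x
  proof -
    have "f x * f x \<le> ip f f"
      unfolding ip_def using finV that(2) by (intro member_le_sum) auto
    then show ?thesis
      using that(1) by (simp add: abs_le_square_iff[of _ 1, simplified] power2_eq_square)
  qed
  then have "?B \<inter> ((\<Inter>u\<in>U. {f. ip f u = 0}) \<inter> {f. ip f f = 1}) = {f \<in> orth U. ip f f = 1}"
    by (fastforce simp: orth_def PiE_iff abs_le_iff split: if_splits)
  ultimately show ?thesis by simp
qed

text \<open>First-order condition at a maximum. The residual \<open>h\<close>, which is
  \<open>app f\<close> minus \<open>l\<close> times \<open>f\<close>, stays in the invariant space.
  Moving from f to f + s h turns the defect \<open>ip g (app g) - l * ip g g\<close>, which is 0 at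
  f and never positive, into 2 s |h|^2 + s^2 c; a small positive s then forces h = 0.\<close>

lemma eigen_of_max:
  assumes inv: "\<And>f. f \<in> orth U \<Longrightarrow> app f \<in> orth U"
    and f: "f \<in> orth U" "ip f (app f) = l * ip f f"
    and max: "\<And>g. g \<in> orth U \<Longrightarrow> ip g (app g) \<le> l * ip g g"
  shows "app f = (\<lambda>x. l * f x)"
proof -
  define h where "h = (\<lambda>x. 1 * app f x + (- l) * f x)"
  have h: "h \<in> orth U" unfolding h_def using f inv by (intro orth_lin) auto
  define c where "c = ip h (app h) - l * ip h h"
  have b: "ip h h = ip h (app f) - l * ip h f"
    by (subst (2) h_def) (simp only: ip_lin_right)
  have le: "2 * s * ip h h + s\<^sup>2 * c \<le> 0" for s
  proof -
    have "ip (\<lambda>x. 1 * f x + s * h x) (app (\<lambda>x. 1 * f x + s * h x))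
        \<le> l * ip (\<lambda>x. 1 * f x + s * h x) (\<lambda>x. 1 * f x + s * h x)"
      using f h by (intro max orth_lin)
    then show ?thesis
      unfolding app_lin ip_lin_left ip_lin_right b c_def
      using f(2) ip_app[of f h] ip_commute[of h f] ip_commute[of h "app f"]
      by (simp add: algebra_simps power2_eq_square)
  qed
  define b where "b = ip h h"
  have "b = 0"
  proof (rule ccontr)
    assume "b \<noteq> 0"
    then have bp: "b > 0" using ip_self_nonneg[of h] by (simp add: b_def)
    \<comment> \<open>The test value s = b / d with d > |c| is small enough for the linear term in s
      to outweigh the quadratic one.\<close>
    define d where "d = 1 + \<bar>c\<bar>"
    have d: "d > 0" by (simp add: d_def)
    have "2 * (b / d) * b + (b / d)\<^sup>2 * c \<le> 0" using le[of "b / d"] by (simp add: b_def)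
    moreover have "2 * (b / d) * b + (b / d)\<^sup>2 * c = (b / d)\<^sup>2 * (2 * d + c)"
      using d by (simp add: power2_eq_square field_simps)
    ultimately have "(b / d)\<^sup>2 * (2 * d + c) \<le> 0"
      by simp
    moreover have "2 * d + c > 0" by (simp add: d_def abs_if)
    ultimately show False using bp d by (simp add: mult_le_0_iff)
  qed
  then have "h = (\<lambda>_. 0)" using ip_self_eq_0[OF h] by (simp add: b_def)
  then show ?thesis by (auto simp: h_def fun_eq_iff)
qed

text \<open>The quadratic form is continuous and attains its maximum \<open>l\<close> on the compact
  unit sphere. Both sides of the bound are homogeneous of degree two, so scaling carries it to the
  whole space.\<close>

lemma max_exists:
  assumes "f0 \<in> orth U" "f0 \<noteq> (\<lambda>_. 0)"
  obtains f l where "f \<in> orth U" "f \<noteq> (\<lambda>_. 0)" "ip f (app f) = l * ip f f"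
    "\<And>g. g \<in> orth U \<Longrightarrow> ip g (app g) \<le> l * ip g g"
proof -
  have normalize: "\<exists>k. k > 0 \<and> (\<lambda>x. k * g x) \<in> orth U \<and> k * k * ip g g = 1"
    if "g \<in> orth U" "g \<noteq> (\<lambda>_. 0)" for g
  proof -
    have "ip g g > 0" using ip_self_eq_0[OF that(1)] ip_self_nonneg[of g] that(2) by simp
    moreover have "(\<lambda>x. 1 / sqrt (ip g g) * g x) \<in> orth U" using that(1) by (rule orth_scale)
    ultimately show ?thesis
      by (intro exI[of _ "1 / sqrt (ip g g)"]) simp
  qed
  have nrm: "ip (\<lambda>x. k * g x) (\<lambda>x. k * g x) = k * k * ip g g"
    "ip (\<lambda>x. k * g x) (app (\<lambda>x. k * g x)) = k * k * ip g (app g)" for k g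
    by (simp_all add: app_scale ip_scale ip_scale_left)
  let ?S = "{f \<in> orth U. ip f f = 1}"
  have ne: "?S \<noteq> {}"
    using normalize[OF assms] nrm(1)[of _ f0] by force
  have "ip f (app f) = (\<Sum>x\<in>V. f x * (\<Sum>y\<in>V. a x y * f y))" for f
    by (simp add: ip_def app_def)
  then have "continuous_on UNIV (\<lambda>f. ip f (app f))"
    by (simp add: continuous_intros continuous_on_product_coordinates)
  then have "continuous_on ?S (\<lambda>f. ip f (app f))"
    by (rule continuous_on_subset) simp
  from continuous_attains_sup[OF compact_sphere ne this]
  obtain f where f: "f \<in> ?S" "\<And>g. g \<in> ?S \<Longrightarrow> ip g (app g) \<le> ip f (app f)" by blast
  show thesis
  proof (rule that[of f "ip f (app f)"])
    show "f \<in> orth U" "ip f (app f) = ip f (app f) * ip f f" using f(1) by auto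
    show "f \<noteq> (\<lambda>_. 0)" using f(1) by (auto simp: ip_def)
    fix g assume g: "g \<in> orth U"
    show "ip g (app g) \<le> ip f (app f) * ip g g"
    proof (cases "g = (\<lambda>_. 0)")
      case True
      then show ?thesis by (simp add: ip_def)
    next
      case False
      from normalize[OF g this] obtain k where k: "k > 0"
        "(\<lambda>x. k * g x) \<in> orth U" "k * k * ip g g = 1" by blast
      have "k * k * ip g (app g) \<le> ip f (app f) * (k * k * ip g g)"
        using f(2)[of "\<lambda>x. k * g x + 0 * g x"] k nrm[of k g] by simp
      then have "(k * k) * ip g (app g) \<le> (k * k) * (ip f (app f) * ip g g)"
        by (simp add: mult_ac)
      then show ?thesis using k(1) by (simp add: mult_le_cancel_left_pos)
    qed
  qed
qed

definition eigvecs :: "('a \<Rightarrow> real) set" where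
  "eigvecs = {f \<in> orth {}. f \<noteq> (\<lambda>_. 0) \<and> (\<exists>l. app f = (\<lambda>x. l * f x))}"

text \<open>The spectral theorem without choosing a basis: by self-adjointness the complement of all
  eigenvectors is invariant, so if it were nonzero a maximiser in it would be an eigenvector
  orthogonal to itself.\<close>

lemma eigvecs_complete: "orth eigvecs = {\<lambda>_. 0}"
proof -
  have inv: "app f \<in> orth eigvecs" if f: "f \<in> orth eigvecs" for f
  proof -
    have "ip (app f) u = 0" if u: "u \<in> eigvecs" for u
    proof -
      obtain l where "app u = (\<lambda>x. l * u x + 0 * u x)" using u by (auto simp: eigvecs_def)
      then have "ip (app f) u = l * ip f u" by (simp only: ip_app ip_lin_right)
      then show ?thesis using f u by (simp add: orth_def)
    qed
    then show ?thesis by (simp add: orth_def app_def)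
  qed
  have "f0 = (\<lambda>_. 0)" if f0: "f0 \<in> orth eigvecs" for f0
  proof (rule ccontr)
    assume "f0 \<noteq> (\<lambda>_. 0)"
    then obtain f l where f: "f \<in> orth eigvecs" "f \<noteq> (\<lambda>_. 0)" "ip f (app f) = l * ip f f"
      "\<And>g. g \<in> orth eigvecs \<Longrightarrow> ip g (app g) \<le> l * ip g g"
      using f0 max_exists by metis
    then have "app f = (\<lambda>x. l * f x)" using eigen_of_max[OF inv] by blast
    then have "f \<in> eigvecs" using f by (auto simp: eigvecs_def orth_def)
    then have "ip f f = 0" using f(1) by (auto simp: orth_def)
    then show False using ip_self_eq_0 f by blast
  qed
  then show ?thesis by (auto simp: orth_def ip_def)
qed

text \<open>The coefficients 1 and -t are spelled out so that \<open>ip_lin_left\<close>,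
  \<open>ip_lin_right\<close> and \<open>orth_lin\<close> match this linear combination.\<close>

definition shift :: "real \<Rightarrow> ('a \<Rightarrow> real) \<Rightarrow> 'a \<Rightarrow> real" where
  "shift t f = (\<lambda>x. 1 * app f x + (- t) * f x)"

lemma ip_shift: "ip (shift t f) g = ip f (shift t g)"
  unfolding shift_def ip_lin_left ip_lin_right ip_app ..

lemma shift_orth: "f \<in> orth {} \<Longrightarrow> shift t f \<in> orth {}"
  unfolding shift_def by (intro orth_lin app_orth_empty)

lemma shift_eig: "app u = (\<lambda>x. l * u x) \<Longrightarrow> shift t u = (\<lambda>x. (l - t) * u x)"
  by (simp add: shift_def fun_eq_iff algebra_simps)

lemma shift_scale: "shift t (\<lambda>x. c * u x) = (\<lambda>x. c * shift t u x)"
  by (simp add: shift_def app_scale fun_eq_iff algebra_simps)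

text \<open>Moving the three shifts across the inner product onto an eigenvector with eigenvalue l
  produces the factor (l - t0)(l - t1)(l - t2) = 0. The image is thus orthogonal to every
  eigenvector.\<close>

lemma cubic:
  assumes spec: "\<And>f l. f \<in> orth {} \<Longrightarrow> f \<noteq> (\<lambda>_. 0) \<Longrightarrow> app f = (\<lambda>x. l * f x) \<Longrightarrow> l \<in> {t0, t1, t2}"
    and f: "f \<in> orth {}"
  shows "shift t0 (shift t1 (shift t2 f)) = (\<lambda>_. 0)"
proof -
  have "ip (shift t0 (shift t1 (shift t2 f))) u = 0" if u: "u \<in> eigvecs" for u
  proof -
    obtain l where l: "app u = (\<lambda>x. l * u x)" using u by (auto simp: eigvecs_def)
    have "ip (shift t0 (shift t1 (shift t2 f))) u
        = (l - t0) * ((l - t1) * ((l - t2) * ip f u))"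
      by (simp only: ip_shift shift_eig[OF l] shift_scale ip_scale)
    then show ?thesis using spec[OF _ _ l] u by (auto simp: eigvecs_def)
  qed
  then have "shift t0 (shift t1 (shift t2 f)) \<in> orth eigvecs"
    using shift_orth[OF shift_orth[OF shift_orth[OF f]], of t0 t1 t2] by (auto simp: orth_def)
  then show ?thesis by (simp add: eigvecs_complete)
qed

end

section \<open>Perron-Frobenius theory for irreducible nonnegative kernels\<close>

locale connected_kernel = symmetric_kernel +
  assumes nonneg: "0 \<le> a x y"
    and conn: "\<lbrakk>X \<subseteq> V; X \<noteq> {}; \<And>x y. x \<in> X \<Longrightarrow> y \<in> V \<Longrightarrow> a x y \<noteq> 0 \<Longrightarrow> y \<in> X\<rbrakk> \<Longrightarrow> X = V"
begin

text \<open>At a zero of f the eigenvalue equation is a vanishing sum of nonnegative terms, so f is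
  zero at all neighbours too; the zero set is closed and hence everything.\<close>

lemma nonneg_eigenvector:
  assumes f: "f \<in> orth {}" "app f = (\<lambda>x. l * f x)" and pos: "\<And>x. x \<in> V \<Longrightarrow> 0 \<le> f x"
    and z: "z \<in> V" "f z = 0"
  shows "f = (\<lambda>_. 0)"
proof -
  have "y \<in> {x \<in> V. f x = 0}" if x: "x \<in> {x \<in> V. f x = 0}" and y: "y \<in> V" "a x y \<noteq> 0" for x y
  proof -
    have "(\<Sum>y\<in>V. a x y * f y) = 0"
      using fun_cong[OF f(2), of x] x by (simp add: app_def)
    then have "a x y * f y = 0"
      using finV pos nonneg y(1) by (subst (asm) sum_nonneg_eq_0_iff) auto
    then show ?thesis using y by simp
  qed
  then have "{x \<in> V. f x = 0} = V" using z by (intro conn) auto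
  then show ?thesis using f(1) by (auto simp: orth_def fun_eq_iff)
qed

text \<open>Since the entries are nonnegative, replacing a maximiser by its absolute value does not
  lower the quadratic form. The absolute value is again a maximiser, hence an eigenvector, and has
  no zero by \<open>nonneg_eigenvector\<close>.\<close>

lemma perron:
  assumes "V \<noteq> {}"
  obtains \<alpha> l where "\<alpha> \<in> orth {}" "\<And>x. x \<in> V \<Longrightarrow> 0 < \<alpha> x" "app \<alpha> = (\<lambda>x. l * \<alpha> x)"
    "\<And>g. g \<in> orth {} \<Longrightarrow> ip g (app g) \<le> l * ip g g"
proof -
  have "(\<lambda>x. if x \<in> V then 1 else 0) \<in> orth {}" "(\<lambda>x. if x \<in> V then 1 else 0::real) \<noteq> (\<lambda>_. 0)"
    using assms by (auto simp: orth_def fun_eq_iff)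
  then obtain f l where f: "f \<in> orth {}" "f \<noteq> (\<lambda>_. 0)" "ip f (app f) = l * ip f f"
    and max: "\<And>g. g \<in> orth {} \<Longrightarrow> ip g (app g) \<le> l * ip g g"
    using max_exists by metis
  define h where "h x = \<bar>f x\<bar>" for x
  have h: "h \<in> orth {}" "h \<noteq> (\<lambda>_. 0)" using f by (auto simp: h_def orth_def fun_eq_iff)
  have hh: "ip h h = ip f f" by (simp add: ip_def h_def)
  have "f x * (a x y * f y) \<le> h x * (a x y * h y)" for x y
    using abs_ge_self[of "f x * (a x y * f y)"] nonneg[of x y] by (simp add: h_def abs_mult)
  then have "ip f (app f) \<le> ip h (app h)"
    by (auto simp: ip_def app_def sum_distrib_left intro!: sum_mono)
  then have "ip h (app h) = l * ip h h" using max[OF h(1)] f(3) hh by simp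
  then have eig: "app h = (\<lambda>x. l * h x)" using h(1) max
    by (intro eigen_of_max[of "{}"] app_orth_empty) auto
  show thesis
  proof (rule that[OF h(1) _ eig max])
    fix x assume x: "x \<in> V"
    have "h x \<noteq> 0" using nonneg_eigenvector[OF h(1) eig _ x] h(2) by (auto simp: h_def)
    then show "0 < h x" by (simp add: h_def)
  qed
qed

text \<open>Subtract from g the largest multiple of \<alpha> that stays below it: the difference is
  a nonnegative eigenvector with a zero where the ratio g / \<alpha> is minimal.\<close>

lemma simple_eigenvalue:
  assumes \<alpha>: "\<alpha> \<in> orth {}" "\<And>x. x \<in> V \<Longrightarrow> 0 < \<alpha> x" "app \<alpha> = (\<lambda>x. l * \<alpha> x)"
    and g: "g \<in> orth {}" "app g = (\<lambda>x. l * g x)"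
  shows "\<exists>c. g = (\<lambda>x. c * \<alpha> x)"
proof (cases "V = {}")
  case True
  moreover have "\<forall>x. x \<notin> V \<longrightarrow> g x = 0" using g(1) by (simp add: orth_def)
  ultimately have "g = (\<lambda>_. 0)" by auto
  then show ?thesis by (intro exI[of _ 0]) simp
next
  case False
  define c where "c = Min ((\<lambda>x. g x / \<alpha> x) ` V)"
  have "c \<in> (\<lambda>x. g x / \<alpha> x) ` V" unfolding c_def using finV False by (intro Min_in) auto
  then obtain z where z: "z \<in> V" "c = g z / \<alpha> z" by blast
  have c: "c \<le> g x / \<alpha> x" if "x \<in> V" for x unfolding c_def using finV that by (intro Min_le) auto
  define h where "h = (\<lambda>x. 1 * g x + (- c) * \<alpha> x)"
  have "h = (\<lambda>_. 0)"
  proof (rule nonneg_eigenvector[of _ l])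
    show "h \<in> orth {}" unfolding h_def using \<alpha> g by (intro orth_lin)
    show "app h = (\<lambda>x. l * h x)" unfolding h_def app_lin \<alpha> g by (simp add: algebra_simps)
    show "z \<in> V" by fact
    show "h z = 0" using z \<alpha>(2)[of z] by (simp add: h_def)
    show "0 \<le> h x" if "x \<in> V" for x using c[OF that] \<alpha>(2)[OF that] by (simp add: h_def field_simps)
  qed
  then show ?thesis by (auto simp: h_def fun_eq_iff intro!: exI[of _ c])
qed

text \<open>By \<open>cubic\<close>, (A - t1)(A - t2) maps every vector into the eigenspace of t0,
  the line through the Perron vector \<beta>. A symmetric operator with this image is a multiple k
  of \<beta>\<beta>^T, and \<alpha> is \<beta> scaled by the square root of k.\<close>

lemma rank_one:
  assumes V: "V \<noteq> {}" and t: "t0 > t1" "t1 > t2"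
    and spec: "\<And>l. (\<exists>f. (\<exists>x\<in>V. f x \<noteq> 0) \<and> (\<forall>x\<in>V. (\<Sum>y\<in>V. a x y * f y) = l * f x)) \<longleftrightarrow> l \<in> {t0, t1, t2}"
  obtains \<alpha> where "\<And>x. x \<in> V \<Longrightarrow> 0 < \<alpha> x"
    "\<And>x y. x \<in> V \<Longrightarrow> y \<in> V \<Longrightarrow> (\<Sum>z\<in>V. a x z * a z y)
       = (t1 + t2) * a x y - (if x = y then t1 * t2 else 0) + \<alpha> x * \<alpha> y"
proof -
  have eig: "l \<in> {t0, t1, t2}" if "f \<in> orth {}" "f \<noteq> (\<lambda>_. 0)" "app f = (\<lambda>x. l * f x)" for f l
    unfolding spec[symmetric]
  proof (intro exI conjI ballI)
    show "\<exists>x\<in>V. f x \<noteq> 0" using that by (auto simp: orth_def fun_eq_iff)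
    show "(\<Sum>y\<in>V. a x y * f y) = l * f x" if "x \<in> V" for x
      using fun_cong[OF \<open>app f = _\<close>, of x] that by (simp add: app_def)
  qed
  obtain \<beta> l where \<beta>: "\<beta> \<in> orth {}" "\<And>x. x \<in> V \<Longrightarrow> 0 < \<beta> x" "app \<beta> = (\<lambda>x. l * \<beta> x)"
    and max: "\<And>g. g \<in> orth {} \<Longrightarrow> ip g (app g) \<le> l * ip g g"
    using perron[OF V] by blast
  have \<beta>ne: "\<beta> \<noteq> (\<lambda>_. 0)" using \<beta>(2) V by (auto simp: fun_eq_iff)
  \<comment> \<open>The Perron value bounds all Rayleigh quotients, so it is at least t0; being an
    eigenvalue, it is one of the three.\<close>
  have "l = t0"
  proof -
    obtain f where f: "\<exists>x\<in>V. f x \<noteq> 0" "\<And>x. x \<in> V \<Longrightarrow> (\<Sum>y\<in>V. a x y * f y) = t0 * f x"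
      using spec[of t0] by auto
    define g where "g x = (if x \<in> V then f x else 0)" for x
    have g: "g \<in> orth {}" "g \<noteq> (\<lambda>_. 0)" using f(1) by (auto simp: g_def orth_def fun_eq_iff)
    have ag: "app g = (\<lambda>x. t0 * g x)" using f(2) by (auto simp: app_def g_def fun_eq_iff)
    have "ip g g > 0" using ip_self_eq_0[OF g(1)] ip_self_nonneg[of g] g(2) by simp
    moreover have "t0 * ip g g \<le> l * ip g g" using max[OF g(1)] by (simp add: ag ip_scale)
    ultimately have "t0 \<le> l" by simp
    then show ?thesis using eig[OF \<beta>(1) \<beta>ne \<beta>(3)] t by auto
  qed
  define N where "N = ip \<beta> \<beta>"
  have N: "N > 0" using ip_self_eq_0[OF \<beta>(1)] ip_self_nonneg[of \<beta>] \<beta>ne by (simp add: N_def)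
  \<comment> \<open>On \<beta> the operator acts as (t0 - t1)(t0 - t2), while k \<beta>\<beta>^T
    acts as k N.\<close>
  define k where "k = (t0 - t1) * (t0 - t2) / N"
  have k: "k > 0" using N t by (simp add: k_def)
  have M: "shift t1 (shift t2 d) x = k * ip d \<beta> * \<beta> x" if d: "d \<in> orth {}" for d x
  proof -
    define m where "m = shift t1 (shift t2 d)"
    have m: "m \<in> orth {}" unfolding m_def using d by (intro shift_orth)
    have "shift t0 m = (\<lambda>_. 0)" unfolding m_def by (rule cubic[OF eig d])
    then have "app m = (\<lambda>x. t0 * m x)" by (simp add: shift_def fun_eq_iff)
    then obtain c where c: "m = (\<lambda>x. c * \<beta> x)"
      using simple_eigenvalue[OF \<beta> m] \<open>l = t0\<close> by auto
    have "ip \<beta> m = (t0 - t1) * ((t0 - t2) * ip \<beta> d)"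
      unfolding m_def ip_shift[symmetric] shift_eig[OF \<beta>(3)] shift_scale
      by (simp only: ip_commute[of _ d] ip_scale \<open>l = t0\<close>)
    moreover have "ip \<beta> m = c * N" by (simp add: c ip_scale N_def)
    ultimately have "c = k * ip d \<beta>" using N by (simp add: k_def field_simps ip_commute)
    then show ?thesis using c by (simp add: m_def)
  qed
  show thesis
  proof (rule that[of "\<lambda>x. sqrt k * \<beta> x"])
    show "0 < sqrt k * \<beta> x" if "x \<in> V" for x using k \<beta>(2)[OF that] by simp
    fix x y assume xy: "x \<in> V" "y \<in> V"
    \<comment> \<open>Applying \<open>M\<close> to the indicator of y and evaluating at x reads off
      the matrix entry (x, y).\<close>
    define d where "d z = (if z = y then 1 else 0::real)" for z
    have d: "d \<in> orth {}" using xy by (auto simp: orth_def d_def)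
    have ad: "app d z = (if z \<in> V then a z y else 0)" for z
      using xy by (simp add: app_def d_def sum_indicator)
    have "shift t1 (shift t2 d) x = (\<Sum>z\<in>V. a x z * (a z y - t2 * d z)) - t1 * (a x y - t2 * d x)"
      using xy by (simp add: shift_def ad) (simp add: app_def ad)
    also have "(\<Sum>z\<in>V. a x z * (a z y - t2 * d z)) = (\<Sum>z\<in>V. a x z * a z y) - t2 * a x y"
      using sum_indicator[OF xy(2), of "\<lambda>z. a x z * t2"]
      by (simp add: right_diff_distrib sum_subtractf d_def mult.assoc mult.commute[of t2])
    finally have "(\<Sum>z\<in>V. a x z * a z y) - t2 * a x y - t1 * (a x y - t2 * d x) = k * ip d \<beta> * \<beta> x"
      using M[OF d, of x] by simp
    moreover have "ip d \<beta> = \<beta> y"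
      using sum_indicator[OF xy(2), of \<beta>] by (simp add: ip_commute[of d]) (simp add: ip_def d_def)
    ultimately have "(\<Sum>z\<in>V. a x z * a z y)
        = (t1 + t2) * a x y - t1 * t2 * d x + k * (\<beta> x * \<beta> y)"
      by (simp add: algebra_simps)
    moreover have "sqrt k * \<beta> x * (sqrt k * \<beta> y) = (sqrt k * sqrt k) * (\<beta> x * \<beta> y)"
      by (simp only: mult_ac)
    then have "sqrt k * \<beta> x * (sqrt k * \<beta> y) = k * (\<beta> x * \<beta> y)"
      using k by (simp only: real_sqrt_mult_self abs_of_pos)
    ultimately show "(\<Sum>z\<in>V. a x z * a z y)
        = (t1 + t2) * a x y - (if x = y then t1 * t2 else 0) + sqrt k * \<beta> x * (sqrt k * \<beta> y)"
      by (simp only: d_def if_distrib[of "\<lambda>c. t1 * t2 * c"] mult_1_right mult_zero_right)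
  qed
qed

end

section \<open>Joins in graphs with a rank one relation\<close>

text \<open>Here k1, k2 are the valencies inside the two sides of a join and n1, n2 their sizes, so
  k1 + n2 and k2 + n1 are the degrees in the whole graph. The outcomes are two edgeless sides or a
  regular graph. For t1 = 0 the equations factor directly; t1 > 0 is contradictory.\<close>

lemma join_parameters:
  fixes t1 t2 k1 k2 n1 n2 :: real
  assumes t: "0 \<le> t1" "t2 < -1"
    and k: "0 \<le> k1" "0 \<le> k2" and n: "k1 + 2 \<le> n1" "k2 + 2 \<le> n2"
    and q: "0 \<le> k1 + t1 * t2" "0 \<le> k2 + t1 * t2"
    and e1: "(k1 - t1) * (k1 - t2) = (k1 + t1 * t2) * n1"
    and e2: "(k2 - t1) * (k2 - t2) = (k2 + t1 * t2) * n2"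
    and e12: "(k1 + k2 - (t1 + t2))\<^sup>2 = (k1 + t1 * t2 + n2) * (k2 + t1 * t2 + n1)"
  shows "k1 = 0 \<and> k2 = 0 \<or> k1 + n2 = k2 + n1"
proof (cases "t1 = 0")
  case True
  have a1: "k1 = 0 \<or> n1 = k1 - t2" using e1 True by auto
  have a2: "k2 = 0 \<or> n2 = k2 - t2" using e2 True by auto
  have p: "k1 + n2 > 0" "k2 + n1 > 0" "k1 + k2 - t2 > 0" using t k n by auto
  have e: "(k1 + k2 - t2) * (k1 + k2 - t2) = (k1 + n2) * (k2 + n1)"
    using e12 True by (simp add: power2_eq_square)
  show ?thesis
  proof (cases "k1 = 0")
    case k1: True
    show ?thesis
    proof (cases "k2 = 0")
      case False
      then have "n2 = k2 - t2" using a2 by simp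
      then have "n2 * n2 = n2 * (k2 + n1)" using e k1 by simp
      then show ?thesis using p k1 by simp
    qed (use k1 in simp)
  next
    case False
    then have n1: "n1 = k1 - t2" using a1 by simp
    show ?thesis
    proof (cases "k2 = 0")
      case True
      then have "n1 * n1 = (k1 + n2) * n1" using e n1 by simp
      then show ?thesis using p True by simp
    next
      case False
      then show ?thesis using n1 a2 by simp
    qed
  qed
next
  case False
  then have t1: "0 < t1" using t by simp
  define d1 d2 where "d1 = k1 - t1" and "d2 = k2 - t1"
  have d: "0 \<le> d1" "0 \<le> d2"
  proof -
    have "0 \<le> d1 * (k1 - t2)" "0 \<le> d2 * (k2 - t2)"
      unfolding d1_def d2_def e1 e2 using q n k by (auto intro!: mult_nonneg_nonneg)
    then show "0 \<le> d1" "0 \<le> d2" using t k by (auto simp: zero_le_mult_iff)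
  qed
  \<comment> \<open>For the quotient matrix \<open>B = (k1, n2; n1, k2)\<close> of the join, \<open>(B - t1)(B - t2)\<close> has rank one,
    so one of \<open>det (B - t1)\<close> and \<open>det (B - t2)\<close> vanishes.\<close>
  have rank: "((k1 - t1) * (k1 - t2) + n1 * n2) * ((k2 - t1) * (k2 - t2) + n1 * n2)
      = n1 * n2 * (k1 + k2 - (t1 + t2))\<^sup>2"
    unfolding e1 e2 e12 by (simp add: algebra_simps)
  have "((k1 - t1) * (k2 - t1) - n1 * n2) * ((k1 - t2) * (k2 - t2) - n1 * n2)
      = ((k1 - t1) * (k1 - t2) + n1 * n2) * ((k2 - t1) * (k2 - t2) + n1 * n2)
        - n1 * n2 * (k1 + k2 - (t1 + t2))\<^sup>2"
    by (simp add: algebra_simps power2_eq_square)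
  then have "((k1 - t1) * (k2 - t1) - n1 * n2) * ((k1 - t2) * (k2 - t2) - n1 * n2) = 0"
    unfolding rank by simp
  \<comment> \<open>This bound makes det (B - t1) nonzero, so det (B - t2) is the determinant that
    vanishes.\<close>
  moreover have "d1 * d2 < n1 * n2"
    using d n k t1 unfolding d1_def d2_def by (intro mult_strict_mono') auto
  ultimately have x: "(k1 - t2) * (k2 - t2) = n1 * n2"
    by (auto simp: d1_def d2_def)
  have n12: "n1 * n2 \<noteq> 0" using n k by auto
  \<comment> \<open>Multiply \<open>e1\<close> by \<open>e2\<close> and cancel n1 n2 = (k1 - t2)(k2
    - t2). The resulting identity factors and fixes k1 + k2, and the sum of the two bounds
    \<open>q\<close> then becomes t1 (1 + t2) >= 0, against t2 < -1.\<close>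
  have "(k1 - t1) * (k2 - t1) * (n1 * n2) = ((k1 - t1) * (k1 - t2)) * ((k2 - t1) * (k2 - t2))"
    unfolding x[symmetric] by (simp only: mult_ac)
  then have "(k1 - t1) * (k2 - t1) * (n1 * n2) = (k1 + t1 * t2) * (k2 + t1 * t2) * (n1 * n2)"
    unfolding e1 e2 by (simp only: mult_ac)
  then have y: "(k1 - t1) * (k2 - t1) = (k1 + t1 * t2) * (k2 + t1 * t2)"
    using n12 by simp
  moreover have "t1 * (1 + t2) * (k1 + k2 - t1 * (1 - t2))
      = (k1 + t1 * t2) * (k2 + t1 * t2) - (k1 - t1) * (k2 - t1)"
    by (simp add: algebra_simps)
  ultimately have "t1 * (1 + t2) * (k1 + k2 - t1 * (1 - t2)) = 0" by simp
  then have "k1 + k2 = t1 * (1 - t2)" using t1 t by auto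
  then have "0 \<le> t1 * (1 + t2)" using q by (simp add: algebra_simps)
  then show ?thesis using t1 t by (simp add: zero_le_mult_iff)
qed

text \<open>Eliminating p leaves k w = q (n - 1 - k), whose left side is nonnegative and whose last
  factor is positive. It is applied with p = t1 + t2 and q = t1 t2.\<close>

lemma sign_from_counts:
  fixes k n p q w :: real
  assumes "k = n + p + q + w" "k * k - p * k + q = (k + q) * n" "0 \<le> k" "0 < w" "k + 2 \<le> n"
  shows "0 \<le> q"
proof -
  have "k * w = q * (n - 1 - k)" using assms(2) unfolding assms(1) by (simp add: algebra_simps)
  moreover have "0 \<le> k * w" using assms by simp
  ultimately have "0 \<le> q * (n - 1 - k)" by simp
  then show ?thesis using assms by (simp add: zero_le_mult_iff)
qed

section \<open>Degrees, nonadjacent pairs and induced paths\<close>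

locale rank_one_graph =
  fixes V :: "'a set" and E :: "'a \<Rightarrow> 'a \<Rightarrow> bool" and \<alpha> :: "'a \<Rightarrow> real" and t1 t2 :: real
  assumes finV: "finite V"
    and symE: "E x y \<Longrightarrow> E y x"
    and irrefl: "\<not> E x x"
    and t: "t2 < t1"
    and pos: "x \<in> V \<Longrightarrow> 0 < \<alpha> x"
    and common: "\<lbrakk>x \<in> V; y \<in> V\<rbrakk> \<Longrightarrow> real (card {z \<in> V. E x z \<and> E y z})
      = (if E x y then t1 + t2 else 0) - (if x = y then t1 * t2 else 0) + \<alpha> x * \<alpha> y"
begin

definition deg :: "'a \<Rightarrow> nat" where
  "deg x = card {z \<in> V. E x z}"

definition is_join :: "'a set \<Rightarrow> 'a set \<Rightarrow> bool" where
  "is_join U W \<longleftrightarrow> U \<union> W = V \<and> U \<inter> W = {} \<and> U \<noteq> {} \<and> W \<noteq> {} \<and> (\<forall>x\<in>U. \<forall>y\<in>W. E x y)"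

lemma is_join_commute: "is_join U W \<Longrightarrow> is_join W U"
  by (auto simp: is_join_def intro: symE)

lemma deg_eq: "x \<in> V \<Longrightarrow> real (deg x) = \<alpha> x * \<alpha> x - t1 * t2"
  using common[of x x] by (simp add: deg_def irrefl)

lemma nonadjacent_le:
  assumes "x \<in> V" "y \<in> V" "x \<noteq> y" "\<not> E x y"
  shows "\<alpha> x * \<alpha> y \<le> \<alpha> x * \<alpha> x - t1 * t2"
proof -
  have "card {z \<in> V. E x z \<and> E y z} \<le> deg x"
    unfolding deg_def using finV by (intro card_mono) auto
  then have "real (card {z \<in> V. E x z \<and> E y z}) \<le> real (deg x)" by simp
  then show ?thesis using common[of x y] deg_eq[of x] assms by simp
qed

text \<open>The common neighbours of x and y number \<alpha> x \<alpha> y, which is at most either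
  degree. The smaller degree gives the sign; if t1 t2 = 0, the two bounds squeeze \<alpha> x and
  \<alpha> y together.\<close>

lemma nonadjacent:
  assumes "x \<in> V" "y \<in> V" "x \<noteq> y" "\<not> E x y"
  shows "t1 * t2 \<le> 0" "t1 * t2 = 0 \<Longrightarrow> \<alpha> x = \<alpha> y"
proof -
  have le: "\<alpha> x * \<alpha> y \<le> \<alpha> x * \<alpha> x - t1 * t2" "\<alpha> y * \<alpha> x \<le> \<alpha> y * \<alpha> y - t1 * t2"
    using nonadjacent_le assms symE by blast+
  have p: "0 < \<alpha> x" "0 < \<alpha> y" using pos assms by auto
  show "t1 * t2 \<le> 0"
  proof (cases "\<alpha> x \<le> \<alpha> y")
    case True
    then have "\<alpha> x * \<alpha> x \<le> \<alpha> x * \<alpha> y" using p by simp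
    then show ?thesis using le by linarith
  next
    case False
    then have "\<alpha> y * \<alpha> y \<le> \<alpha> y * \<alpha> x" using p by simp
    then show ?thesis using le by linarith
  qed
  show "\<alpha> x = \<alpha> y" if "t1 * t2 = 0"
    using le p that by simp
qed

text \<open>Common neighbours of x and y miss y among the neighbours of x, and miss both x and z
  among those of y. Comparing with the degree of the endpoint where \<alpha> is smaller gives (t1 +
  1)(t2 + 1) < 0; the second missing vertex provides strictness in case of a tie.\<close>

lemma induced_path:
  assumes V: "x \<in> V" "y \<in> V" "z \<in> V" and E: "E x y" "E y z" "\<not> E x z" "x \<noteq> z"
  shows "0 \<le> t1" "t2 < -1"
proof -
  have q: "t1 * t2 \<le> 0" using nonadjacent(1)[OF V(1,3) E(4,3)] .
  show t1: "0 \<le> t1"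
  proof (rule ccontr)
    assume "\<not> 0 \<le> t1"
    then have "0 < t1 * t2" using t by (intro mult_neg_neg) auto
    then show False using q by simp
  qed
  have "card {w \<in> V. E x w \<and> E y w} \<le> card ({w \<in> V. E x w} - {y})"
    using finV irrefl by (intro card_mono) auto
  also have "\<dots> < deg x"
    unfolding deg_def using finV V(2) E(1) by (intro card_Diff1_less) auto
  finally have cx: "real (card {w \<in> V. E x w \<and> E y w}) \<le> real (deg x) - 1"
    by linarith
  have "{w \<in> V. E x w \<and> E y w} \<inter> {x, z} = {}"
    using E(3) irrefl by blast
  then have "card {w \<in> V. E x w \<and> E y w} + card {x, z} = card ({w \<in> V. E x w \<and> E y w} \<union> {x, z})"
    using finV by (intro card_Un_disjoint[symmetric]) simp_all
  also have "\<dots> \<le> deg y"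
    unfolding deg_def using finV V symE[OF E(1)] E(2) by (intro card_mono) auto
  finally have cy: "real (card {w \<in> V. E x w \<and> E y w}) \<le> real (deg y) - 2"
    using E(4) by simp
  have c: "real (card {w \<in> V. E x w \<and> E y w}) = t1 + t2 + \<alpha> x * \<alpha> y"
    using common[of x y] V E irrefl by auto
  have p: "0 < \<alpha> x" "0 < \<alpha> y" using pos V by auto
  have "(t1 + 1) * (t2 + 1) < 0"
  proof (cases "\<alpha> x < \<alpha> y")
    case True
    then have "\<alpha> x * \<alpha> x < \<alpha> x * \<alpha> y" using p by simp
    then show ?thesis using c cx deg_eq[OF V(1)] by (simp add: algebra_simps)
  next
    case False
    then have "\<alpha> y * \<alpha> y \<le> \<alpha> x * \<alpha> y" using p by simp
    then show ?thesis using c cy deg_eq[OF V(2)] by (simp add: algebra_simps)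
  qed
  then show "t2 < -1" using t1 by (simp add: mult_less_0_iff)
qed

section \<open>Joins: the relation across the two sides, and regularity of each side\<close>

lemma join_adjacent:
  assumes j: "is_join U W" and x: "x \<in> U" and y: "y \<in> W"
  shows "\<alpha> x * \<alpha> x + \<alpha> y * \<alpha> y - \<alpha> x * \<alpha> y = real (card V) + (t1 + t2) + 2 * (t1 * t2)"
proof -
  have V: "x \<in> V" "y \<in> V" and E: "E x y" "x \<noteq> y" using assms by (auto simp: is_join_def)
  \<comment> \<open>In a join every vertex is adjacent to x or to y, so inclusion-exclusion relates
    the two degrees to the common neighbours.\<close>
  have "{z \<in> V. E x z} \<union> {z \<in> V. E y z} = V"
    using j x y symE by (auto simp: is_join_def)
  moreover have "{z \<in> V. E x z} \<inter> {z \<in> V. E y z} = {z \<in> V. E x z \<and> E y z}" by auto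
  ultimately have "deg x + deg y = card V + card {z \<in> V. E x z \<and> E y z}"
    using card_Un_Int[of "{z \<in> V. E x z}" "{z \<in> V. E y z}"] finV by (simp add: deg_def)
  then have "real (deg x) + real (deg y) = real (card V) + real (card {z \<in> V. E x z \<and> E y z})"
    by (simp flip: of_nat_add)
  then show ?thesis using common[OF V] E deg_eq V by simp
qed

lemma card_join: "is_join U W \<Longrightarrow> card V = card U + card W"
  using finV by (auto simp: is_join_def card_Un_disjoint)

lemma deg_join:
  assumes "is_join U W" "x \<in> U"
  shows "deg x = card {z \<in> U. E x z} + card W"
proof -
  have "{z \<in> V. E x z} = {z \<in> U. E x z} \<union> W" using assms by (auto simp: is_join_def)
  then show ?thesis
    unfolding deg_def using assms finV by (subst card_Un_disjoint[symmetric]) (auto simp: is_join_def)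
qed

lemma not_cone_nonadjacent:
  assumes "is_join U W" "x \<in> U" "deg x \<noteq> card V - 1"
  obtains z where "z \<in> U" "x \<noteq> z" "\<not> E x z"
proof -
  have "\<exists>z\<in>U. x \<noteq> z \<and> \<not> E x z"
  proof (rule ccontr)
    assume "\<not> ?thesis"
    then have "{z \<in> V. E x z} = V - {x}" using assms irrefl by (auto simp: is_join_def)
    then have "deg x = card V - 1" using assms finV by (auto simp: deg_def is_join_def)
    then show False using assms by simp
  qed
  then show ?thesis using that by blast
qed

text \<open>Constant \<alpha> makes all degrees on U equal, so U induces a k-regular graph. As the
  graph is not a cone, some pair in U is nonadjacent: this gives k + 2 \<le> \<open>card U\<close>,
  and since all of W is common to the pair, c^2 is at least \<open>card W\<close>.\<close>

lemma join_side:
  assumes j: "is_join U W" and c: "\<And>x. x \<in> U \<Longrightarrow> \<alpha> x = c"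
    and nc: "\<And>x. x \<in> V \<Longrightarrow> deg x \<noteq> card V - 1"
  shows "\<exists>k::nat. (\<forall>x\<in>U. card {z \<in> U. E x z} = k) \<and>
    c * c = real k + t1 * t2 + real (card W) \<and> k + 2 \<le> card U \<and> 0 \<le> real k + t1 * t2 \<and>
    (real k - t1) * (real k - t2) = (real k + t1 * t2) * real (card U)"
proof -
  obtain x where x: "x \<in> U" using j by (auto simp: is_join_def)
  define k where "k = card {z \<in> U. E x z}"
  have UV: "U \<subseteq> V" "finite U" "finite W" using j finV by (auto simp: is_join_def)
  have eq: "real (card {z \<in> U. E y z}) + real (card W) = c * c - t1 * t2" if "y \<in> U" for y
    using deg_eq[of y] deg_join[OF j that] c[OF that] that UV by auto
  have k: "card {z \<in> U. E y z} = k" if "y \<in> U" for y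
    using eq[OF that] eq[OF x] by (simp add: k_def)
  have cc: "c * c = real k + t1 * t2 + real (card W)" using eq[OF x] by (simp add: k_def)
  obtain y where y: "y \<in> U" "x \<noteq> y" "\<not> E x y"
    using not_cone_nonadjacent[OF j x nc] x UV by blast
  have "k + card {x, y} = card ({z \<in> U. E x z} \<union> {x, y})"
    unfolding k_def using UV y irrefl by (subst card_Un_disjoint) auto
  also have "\<dots> \<le> card U" using UV x y by (intro card_mono) auto
  finally have kU: "k + 2 \<le> card U" using y by simp
  have "card W \<le> card {z \<in> V. E x z \<and> E y z}"
    using finV j x y by (intro card_mono) (auto simp: is_join_def)
  then have "real (card W) \<le> real (card {z \<in> V. E x z \<and> E y z})" by simp
  also have "\<dots> = c * c" using common[of x y] UV x y c by (auto simp: subset_iff)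
  finally have q: "0 \<le> real k + t1 * t2" using cc by simp
  have V: "V = U \<union> W" "U \<inter> W = {}" and EW: "\<And>y z. y \<in> U \<Longrightarrow> z \<in> W \<Longrightarrow> E y z"
    using j by (auto simp: is_join_def)
  \<comment> \<open>Double counting of walks x - z - y with x fixed and y in U. Summing over z
    first, the k neighbours of x in U contribute k each, and every z in W contributes
    \<open>card U\<close>; the relation \<open>common\<close> evaluates the same sum in terms of
    c.\<close>
  have "(\<Sum>y\<in>U. card {z \<in> V. E x z \<and> E y z}) = (\<Sum>y\<in>U. \<Sum>z\<in>V. of_bool (E x z \<and> E y z))"
    using finV by (simp add: sum_of_bool_eq Int_def)
  also have "\<dots> = (\<Sum>z\<in>V. \<Sum>y\<in>U. of_bool (E x z \<and> E y z))" by (rule sum.swap)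
  also have "\<dots> = (\<Sum>z\<in>V. of_bool (E x z) * card {y \<in> U. E z y})"
    using UV symE by (intro sum.cong) (auto simp: sum_of_bool_eq Int_def intro!: arg_cong[of _ _ card])
  also have "\<dots> = (\<Sum>z\<in>U. of_bool (E x z) * card {y \<in> U. E z y})
      + (\<Sum>z\<in>W. of_bool (E x z) * card {y \<in> U. E z y})"
    unfolding V(1) using UV V(2) by (intro sum.union_disjoint)
  also have "(\<Sum>z\<in>U. of_bool (E x z) * card {y \<in> U. E z y}) = (\<Sum>z\<in>U. of_bool (E x z) * k)"
    by (simp add: k)
  also have "(\<Sum>z\<in>W. of_bool (E x z) * card {y \<in> U. E z y}) = (\<Sum>z\<in>W. card U)"
  proof (rule sum.cong)
    fix z assume z: "z \<in> W"
    have "{y \<in> U. E z y} = U" using symE[OF EW[OF _ z]] by auto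
    then show "of_bool (E x z) * card {y \<in> U. E z y} = card U" using EW[OF x z] by simp
  qed simp
  also have "(\<Sum>z\<in>U. of_bool (E x z) * k) + (\<Sum>z\<in>W. card U) = k * k + card W * card U"
  proof -
    have "(\<Sum>z\<in>U. of_bool (E x z)) = k" using UV by (simp add: sum_of_bool_eq Int_def k_def)
    then have "(\<Sum>z\<in>U. of_bool (E x z) * k) = k * k" by (metis sum_distrib_right)
    then show ?thesis by (simp only: sum_constant of_nat_id)
  qed
  finally have "real (\<Sum>y\<in>U. card {z \<in> V. E x z \<and> E y z}) = real (k * k + card W * card U)"
    by (rule arg_cong)
  then have count: "(\<Sum>y\<in>U. real (card {z \<in> V. E x z \<and> E y z}))
      = real k * real k + real (card W) * real (card U)"
    by (simp only: of_nat_sum of_nat_add of_nat_mult)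
  have "(\<Sum>y\<in>U. real (card {z \<in> V. E x z \<and> E y z}))
      = (\<Sum>y\<in>U. (if E x y then t1 + t2 else 0) - (if x = y then t1 * t2 else 0) + c * c)"
    using common UV x c by (intro sum.cong) (auto simp: subset_iff)
  also have "\<dots> = real k * (t1 + t2) - t1 * t2 + real (card U) * (c * c)"
    using UV x by (simp add: sum.distrib sum_subtractf sum.If_cases sum.delta Int_def k_def)
  finally have "real k * real k + real (card W) * real (card U)
      = real k * (t1 + t2) - t1 * t2 + real (card U) * (c * c)"
    using count by simp
  then have "(real k - t1) * (real k - t2) = (real k + t1 * t2) * real (card U)"
    unfolding cc by (simp add: algebra_simps)
  with k cc kU q show ?thesis by blast
qed

text \<open>If \<alpha> took values s and u on U, it would be s + u on W, so
  \<open>join_side\<close> applies to W and yields t1 t2 >= 0. A nonadjacent pair in U gives the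
  reverse inequality, and the remaining case t1 t2 = 0 is refuted by a second join separating x from
  x'.\<close>

lemma join_side_constant:
  assumes j: "is_join U W" and nc: "\<And>x. x \<in> V \<Longrightarrow> deg x \<noteq> card V - 1"
    and x: "x \<in> U" "x' \<in> U"
  shows "\<alpha> x = \<alpha> x'"
proof (rule ccontr)
  assume ne: "\<alpha> x \<noteq> \<alpha> x'"
  have UV: "U \<subseteq> V" "W \<subseteq> V" using j by (auto simp: is_join_def)
  define s u where "s = \<alpha> x" and "u = \<alpha> x'"
  have su: "0 < s" "0 < u" "s \<noteq> u" using pos x UV ne by (auto simp: s_def u_def)
  \<comment> \<open>For fixed y, \<open>join_adjacent\<close> is a monic quadratic in the value on U
    with roots s and u, whose sum is \<alpha> y.\<close>
  have W: "\<alpha> y = s + u" if y: "y \<in> W" for y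
  proof -
    have "s * s + \<alpha> y * \<alpha> y - s * \<alpha> y = u * u + \<alpha> y * \<alpha> y - u * \<alpha> y"
      using join_adjacent[OF j x(1) y] join_adjacent[OF j x(2) y] by (simp add: s_def u_def)
    then have "(s - u) * (s + u - \<alpha> y) = 0" by (simp add: algebra_simps)
    then show ?thesis using su by simp
  qed
  obtain y where y: "y \<in> W" using j by (auto simp: is_join_def)
  have eq: "s * s + u * u + s * u = real (card V) + (t1 + t2) + 2 * (t1 * t2)"
    using join_adjacent[OF j x(1) y] W[OF y] by (simp add: s_def[symmetric] algebra_simps)
  obtain k where k: "(s + u) * (s + u) = real k + t1 * t2 + real (card U)" "k + 2 \<le> card W"
      "0 \<le> real k + t1 * t2" "(real k - t1) * (real k - t2) = (real k + t1 * t2) * real (card W)"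
    using join_side[OF is_join_commute[OF j] W nc] by blast
  \<comment> \<open>From (s + u)^2 = (s^2 + u^2 + s u) + s u, where the bracket is the constant of
    the join; s u plays the role of w in \<open>sign_from_counts\<close>.\<close>
  have "real k = real (card W) + (t1 + t2) + t1 * t2 + s * u"
    using k(1) eq card_join[OF j] by (simp add: distrib_left distrib_right mult.commute)
  moreover have "real k * real k - (t1 + t2) * real k + t1 * t2 = (real k + t1 * t2) * real (card W)"
    unfolding k(4)[symmetric] by (simp add: algebra_simps)
  ultimately have "0 \<le> t1 * t2"
    by (rule sign_from_counts) (use k(2) su in auto)
  obtain z where z: "z \<in> U" "x \<noteq> z" "\<not> E x z"
    using not_cone_nonadjacent[OF j x(1) nc] x UV by blast
  have "t1 * t2 \<le> 0" using nonadjacent(1)[of x z] x z UV by auto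
  then have q: "t1 * t2 = 0" using \<open>0 \<le> t1 * t2\<close> by simp
  \<comment> \<open>Now nonadjacent vertices have equal \<open>\<alpha>\<close>, so the level set of \<open>s\<close> is itself a factor of a join.\<close>
  have "is_join {z \<in> U. \<alpha> z = s} (V - {z \<in> U. \<alpha> z = s})"
    unfolding is_join_def
  proof (intro conjI ballI)
    show "{z \<in> U. \<alpha> z = s} \<noteq> {}" "V - {z \<in> U. \<alpha> z = s} \<noteq> {}"
      using x ne UV by (auto simp: s_def)
    fix v w assume v: "v \<in> {z \<in> U. \<alpha> z = s}" and w: "w \<in> V - {z \<in> U. \<alpha> z = s}"
    show "E v w"
    proof (cases "w \<in> W")
      case True
      then show ?thesis using v j by (auto simp: is_join_def)
    next
      case False
      then have "\<alpha> w \<noteq> \<alpha> v" using v w j by (auto simp: is_join_def)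
      then show ?thesis using nonadjacent(2)[of v w] q v w UV by auto
    qed
  qed (use UV in auto)
  \<comment> \<open>Now x and x' lie on different sides, so the same constant also equals s^2 + u^2
    - s u.\<close>
  from join_adjacent[OF this, of x x'] have "s * s + u * u - s * u = s * s + u * u + s * u"
    using x ne UV eq by (auto simp: s_def u_def)
  then show False using su by simp
qed

text \<open>Both sides satisfy \<open>join_side\<close>, and squaring \<alpha> x \<alpha> y supplies
  the mixed equation of \<open>join_parameters\<close>. Its regular outcome is ruled out by
  \<open>nr\<close>.\<close>

lemma join_complete_bipartite:
  assumes j: "is_join U W" and nc: "\<And>x. x \<in> V \<Longrightarrow> deg x \<noteq> card V - 1"
    and nr: "\<not> (\<exists>k. \<forall>x\<in>V. deg x = k)"
  shows "(\<forall>x\<in>U. \<forall>y\<in>U. \<not> E x y) \<and> (\<forall>x\<in>W. \<forall>y\<in>W. \<not> E x y)"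
proof -
  have j': "is_join W U" using is_join_commute[OF j] .
  obtain x y where x: "x \<in> U" and y: "y \<in> W" using j by (auto simp: is_join_def)
  have V: "U \<subseteq> V" "W \<subseteq> V" "V = U \<union> W" "finite U" "finite W" using j finV by (auto simp: is_join_def)
  obtain k1 where k1: "\<forall>x\<in>U. card {z \<in> U. E x z} = k1"
    "\<alpha> x * \<alpha> x = real k1 + t1 * t2 + real (card W)" "k1 + 2 \<le> card U" "0 \<le> real k1 + t1 * t2"
    "(real k1 - t1) * (real k1 - t2) = (real k1 + t1 * t2) * real (card U)"
    using join_side[OF j join_side_constant[OF j nc _ x] nc] by blast
  obtain k2 where k2: "\<forall>x\<in>W. card {z \<in> W. E x z} = k2"
    "\<alpha> y * \<alpha> y = real k2 + t1 * t2 + real (card U)" "k2 + 2 \<le> card W" "0 \<le> real k2 + t1 * t2"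
    "(real k2 - t1) * (real k2 - t2) = (real k2 + t1 * t2) * real (card W)"
    using join_side[OF j' join_side_constant[OF j' nc _ y] nc] by blast
  have "\<alpha> x * \<alpha> y = real k1 + real k2 - (t1 + t2)"
    using join_adjacent[OF j x y] k1(2) k2(2) card_join[OF j] by simp
  then have e12: "(real k1 + real k2 - (t1 + t2))\<^sup>2
      = (real k1 + t1 * t2 + real (card W)) * (real k2 + t1 * t2 + real (card U))"
    unfolding k1(2)[symmetric] k2(2)[symmetric] by (simp add: power2_eq_square mult_ac)
  obtain z where z: "z \<in> U" "x \<noteq> z" "\<not> E x z"
    using not_cone_nonadjacent[OF j x nc] x V by blast
  \<comment> \<open>Two nonadjacent vertices of U and any vertex of W form an induced path, which
    gives the signs of t1 and t2 + 1.\<close>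
  have "E x y" "E y z" using j x y z symE by (auto simp: is_join_def)
  then have t12: "0 \<le> t1" "t2 < -1" using induced_path[of x y z] x y z V by auto
  have "k1 + card W \<noteq> k2 + card U"
  proof
    assume "k1 + card W = k2 + card U"
    then have "\<forall>v\<in>V. deg v = k1 + card W"
      using deg_join[OF j] deg_join[OF j'] k1(1) k2(1) V by auto
    then show False using nr by blast
  qed
  then have "real k1 + real (card W) \<noteq> real k2 + real (card U)"
    by (simp flip: of_nat_add)
  then have "k1 = 0" "k2 = 0"
    using join_parameters[OF t12 _ _ _ _ k1(4) k2(4) k1(5) k2(5) e12] k1(3) k2(3) by auto
  then show ?thesis using k1(1) k2(1) V by auto
qed

end

section \<open>Graphs with disconnected complement\<close>

lemma out_degree_pair_graph:
  assumes "pair_graph G"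
  shows "out_degree (with_proj G) v = card {w \<in> pverts G. (v, w) \<in> parcs G}"
proof -
  interpret pair_graph G by fact
  have "out_arcs (with_proj G) v = Pair v ` {w \<in> pverts G. (v, w) \<in> parcs G}"
    by (auto simp: out_arcs_def intro: in_arcsD2)
  then show ?thesis
    by (simp add: out_degree_def card_image inj_on_def)
qed

text \<open>Translates reachability into the closed-set form of irreducibility that
  \<open>connected_kernel\<close> asks for.\<close>

lemma connected_closed_subset:
  assumes G: "pair_graph G" "Digraph_Component.connected (with_proj G)"
    and X: "X \<subseteq> pverts G" "X \<noteq> {}" "\<And>x y. x \<in> X \<Longrightarrow> (x, y) \<in> parcs G \<Longrightarrow> y \<in> X"
  shows "X = pverts G"
proof -
  interpret pair_graph G by fact
  obtain u where u: "u \<in> X" using X by blast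
  have "v \<in> X" if v: "v \<in> pverts G" for v
  proof -
    have "(u, v) \<in> rtrancl_on (pverts G) ((parcs G)\<^sup>s)"
      using G(2) u v X(1) by (auto simp: connected_conv)
    then have "(u, v) \<in> ((parcs G)\<^sup>s)\<^sup>*" by (rule rtrancl_on_rtranclI)
    then show ?thesis
    proof (induction rule: rtrancl_induct)
      case (step y z)
      then have "(y, z) \<in> parcs G"
        using arcs_ends_symmetric[OF pair_sym_arcs] by (auto simp: symcl_def)
      then show ?case using X(3) step by blast
    qed (rule u)
  qed
  then show ?thesis using X(1) by blast
qed

text \<open>U is the component of u in the complement: a pair from U and its outside that is not an
  arc of G would be an arc of the complement and extend the component.\<close>

lemma disconnected_complement_join:
  assumes "pverts G \<noteq> {}" "\<not> Digraph_Component.connected (with_proj (complement_graph G))"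
  obtains U W where "U \<union> W = pverts G" "U \<inter> W = {}" "U \<noteq> {}" "W \<noteq> {}"
    "\<forall>x\<in>U. \<forall>y\<in>W. (x, y) \<in> parcs G"
proof -
  let ?V = "pverts G" and ?R = "(parcs (complement_graph G))\<^sup>s"
  obtain u v where uv: "u \<in> ?V" "v \<in> ?V" "(u, v) \<notin> rtrancl_on ?V ?R"
    using assms by (auto simp: connected_conv complement_graph_def)
  define U where "U = {w \<in> ?V. (u, w) \<in> rtrancl_on ?V ?R}"
  show thesis
  proof (rule that[of U "?V - U"])
    show "U \<noteq> {}" using uv by (auto simp: U_def)
    show "?V - U \<noteq> {}" using uv by (auto simp: U_def)
    show "\<forall>x\<in>U. \<forall>y\<in>?V - U. (x, y) \<in> parcs G"
    proof (intro ballI, rule ccontr)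
      fix x y assume x: "x \<in> U" and y: "y \<in> ?V - U"
      assume "(x, y) \<notin> parcs G"
      then have "(x, y) \<in> ?R" using x y by (auto simp: complement_graph_def symcl_def U_def)
      then have "(u, y) \<in> rtrancl_on ?V ?R"
        using x y by (auto simp: U_def intro: rtrancl_on_into_rtrancl_on)
      then show False using y by (simp add: U_def)
    qed
  qed (auto simp: U_def)
qed

theorem theorem2p2:
  fixes \<theta>0 \<theta>1 \<theta>2 :: real and \<Gamma> :: "'a pair_pre_digraph"
  assumes "\<theta>0 > \<theta>1" and "\<theta>1 > \<theta>2"
    and "\<Gamma> \<in> three_eigenvalue_graphs \<theta>0 \<theta>1 \<theta>2"
    and "\<not> Digraph_Component.connected (with_proj (complement_graph \<Gamma>))"
  shows "cone_graph \<Gamma> \<or> complete_bipartite_graph \<Gamma>"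
proof (cases "cone_graph \<Gamma>")
  case True
  then show ?thesis ..
next
  case nc: False
  let ?V = "pverts \<Gamma>"
  define E where "E x y \<longleftrightarrow> (x, y) \<in> parcs \<Gamma>" for x y
  define a where "a x y = (if E x y then 1 else 0::real)" for x y
  have \<Gamma>: "pair_graph \<Gamma>" "Digraph_Component.connected (with_proj \<Gamma>)" "\<not> regular_graph \<Gamma>"
    "graph_eigenvalues \<Gamma> = {\<theta>0, \<theta>1, \<theta>2}"
    using assms(3) by (auto simp: three_eigenvalue_graphs_def)
  interpret pair_graph \<Gamma> by (rule \<Gamma>(1))
  have fin: "finite ?V" by (rule pair_finite_verts)
  have ne: "?V \<noteq> {}" using \<Gamma>(2) by (simp add: connected_conv)
  have symE: "E x y \<Longrightarrow> E y x" for x y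
    using arcs_ends_symmetric[OF pair_sym_arcs] by (auto simp: E_def)
  have irrefl: "\<not> E x x" for x using pair_no_loops by (force simp: E_def)
  interpret K: connected_kernel ?V a
  proof
    show "a x y = a y x" for x y using symE[of x y] symE[of y x] by (auto simp: a_def)
    fix X assume X: "X \<subseteq> ?V" "X \<noteq> {}"
      and closed: "\<And>x y. x \<in> X \<Longrightarrow> y \<in> ?V \<Longrightarrow> a x y \<noteq> 0 \<Longrightarrow> y \<in> X"
    show "X = ?V"
    proof (rule connected_closed_subset[OF \<Gamma>(1,2) X])
      show "y \<in> X" if "x \<in> X" "(x, y) \<in> parcs \<Gamma>" for x y
        using closed[OF that(1) in_arcsD2[OF that(2)]] that(2) by (simp add: a_def E_def)
    qed
  qed (auto simp: fin a_def)
  \<comment> \<open>One enumeration determines all eigenvalues; through it they become eigenvalues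
    of the kernel \<open>a\<close>, the form needed by \<open>rank_one\<close>.\<close>
  obtain vs where vs: "distinct vs" "set vs = ?V" using finite_distinct_list[OF fin] by blast
  have spec: "(\<exists>f. (\<exists>x\<in>?V. f x \<noteq> 0) \<and> (\<forall>x\<in>?V. (\<Sum>y\<in>?V. a x y * f y) = l * f x)) \<longleftrightarrow> l \<in> {\<theta>0, \<theta>1, \<theta>2}" for l
  proof -
    have "a x y * f y = (if (x, y) \<in> parcs \<Gamma> then f y else 0)" for f :: "'a \<Rightarrow> real" and x y
      by (simp add: a_def E_def)
    then show ?thesis
      unfolding \<Gamma>(4)[symmetric] graph_eigenvalues_eq_spectrum[OF vs] spectrum_adjacency_matrix_iff[OF vs(1)] vs(2)
      by simp
  qed
  obtain \<alpha> where \<alpha>: "\<And>x. x \<in> ?V \<Longrightarrow> 0 < \<alpha> x"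
    and sq: "\<And>x y. x \<in> ?V \<Longrightarrow> y \<in> ?V \<Longrightarrow> (\<Sum>z\<in>?V. a x z * a z y)
       = (\<theta>1 + \<theta>2) * a x y - (if x = y then \<theta>1 * \<theta>2 else 0) + \<alpha> x * \<alpha> y"
    using K.rank_one[OF ne assms(1,2) spec] by blast
  interpret R: rank_one_graph ?V E \<alpha> \<theta>1 \<theta>2
  proof
    fix x y assume xy: "x \<in> ?V" "y \<in> ?V"
    have "(\<Sum>z\<in>?V. a x z * a z y) = (\<Sum>z\<in>?V. of_bool (E x z \<and> E y z))"
      using symE[of y] symE[of _ y] by (intro sum.cong refl) (simp add: a_def, blast)
    also have "\<dots> = real (card {z \<in> ?V. E x z \<and> E y z})"
      using fin by (simp add: Int_def)
    finally show "real (card {z \<in> ?V. E x z \<and> E y z})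
        = (if E x y then \<theta>1 + \<theta>2 else 0) - (if x = y then \<theta>1 * \<theta>2 else 0) + \<alpha> x * \<alpha> y"
      using sq[OF xy] by (simp add: a_def split: if_splits)
  qed (rule fin irrefl assms(2) | erule symE \<alpha>)+
  have deg: "out_degree (with_proj \<Gamma>) v = R.deg v" for v
    by (simp add: out_degree_pair_graph[OF \<Gamma>(1)] R.deg_def E_def)
  obtain U W where UW: "U \<union> W = ?V" "U \<inter> W = {}" "U \<noteq> {}" "W \<noteq> {}"
    "\<forall>x\<in>U. \<forall>y\<in>W. (x, y) \<in> parcs \<Gamma>"
    by (rule disconnected_complement_join[OF ne assms(4)])
  have j: "R.is_join U W" using UW by (simp add: R.is_join_def E_def)
  have ind: "(\<forall>x\<in>U. \<forall>y\<in>U. \<not> E x y) \<and> (\<forall>x\<in>W. \<forall>y\<in>W. \<not> E x y)"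
    using nc \<Gamma>(3)
    by (intro R.join_complete_bipartite[OF j]) (auto simp: cone_graph_def regular_graph_def deg)
  have "parcs \<Gamma> = U \<times> W \<union> W \<times> U"
  proof (intro equalityI subrelI)
    fix x y assume xy: "(x, y) \<in> parcs \<Gamma>"
    then have "x \<in> U \<union> W" "y \<in> U \<union> W"
      unfolding UW(1) by (rule in_arcsD1, rule in_arcsD2)
    then show "(x, y) \<in> U \<times> W \<union> W \<times> U"
      using ind xy by (auto simp: E_def)
  next
    fix x y assume "(x, y) \<in> U \<times> W \<union> W \<times> U"
    then have "E x y \<or> E y x" using UW(5) by (auto simp: E_def)
    then have "E x y" using symE by blast
    then show "(x, y) \<in> parcs \<Gamma>" by (simp add: E_def)
  qed
  then have "complete_bipartite_digraph (card U) (card W) (with_proj \<Gamma>)"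
    unfolding complete_bipartite_digraph_pair_def using fin UW(1,2) by blast
  moreover have "1 \<le> card U" "1 \<le> card W"
    using fin UW(1,3,4) finite_Un[of U W] by (simp_all add: Suc_le_eq card_gt_0_iff)
  ultimately have "complete_bipartite_graph \<Gamma>"
    unfolding complete_bipartite_graph_def by blast
  then show ?thesis ..
qed

end
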